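(* Let $X$ be a topological space, let $L = \Omega(X)$ be its locale of open sets, and let $\Omega(L)$ be the Scott topology on $L$. For $\mathcal{U} \in \Omega(L)$ put $$\phi(\mathcal{U}) = \bigcup\{U \in L \mid \exists V \in \mathcal{U},\ U \cap V = \emptyset\},$$ and let $f : X \to L$ be the map defined by $f(x) = \phi(\mathcal{N}_x)$ for each $x\in X$. Then for all $\mathcal{U} \in \Omega(L)$ we have $f^{-1}(\mathcal{U}) = \phi(\mathcal{U})$; hence $f$ is a continuous map from $X$ to $L$ equipped with the Scott topology.
   Context: $\Omega(X)$ is the frame of open sets of $X$ ordered by inclusion. For $x \in X$, $\mathcal{N}_x \subseteq L$ denotes the set of all open neighborhoods of $x$; it is an open set of the Scott topology of $L$. The Scott topology on a locale $L$ has as open sets the upward closed subsets $\mathcal{U} \subseteq L$ such that for every directed (nonempty) subset $D \subseteq L$ with $\bigvee D \in \mathcal{U}$ one has $D \cap \mathcal{U} \neq \emptyset$. *)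

theory Defs
  imports "HOL-Analysis.Abstract_Topology" "HOL-Algebra.Complete_Lattice"
begin

definition open_locale :: "'a topology \<Rightarrow> 'a set gorder"
  where "open_locale X = \<lparr>carrier = {U. openin X U}, eq = (=), le = (\<subseteq>)\<rparr>"

definition directed_in :: "('a, 'b) gorder_scheme \<Rightarrow> 'a set \<Rightarrow> bool"
  where "directed_in L D \<longleftrightarrow>
    D \<subseteq> carrier L \<and> D \<noteq> {} \<and> (\<forall>x\<in>D. \<forall>y\<in>D. \<exists>z\<in>D. x \<sqsubseteq>\<^bsub>L\<^esub> z \<and> y \<sqsubseteq>\<^bsub>L\<^esub> z)"

definition scott_open :: "('a, 'b) gorder_scheme \<Rightarrow> 'a set \<Rightarrow> bool"
  where "scott_open L \<U> \<longleftrightarrow>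
    \<U> \<subseteq> carrier L \<and>
    (\<forall>x\<in>\<U>. \<forall>y\<in>carrier L. x \<sqsubseteq>\<^bsub>L\<^esub> y \<longrightarrow> y \<in> \<U>) \<and>
    (\<forall>D. directed_in L D \<and> \<Squnion>\<^bsub>L\<^esub>D \<in> \<U> \<longrightarrow> D \<inter> \<U> \<noteq> {})"

text \<open>The abstraction \<open>topology\<close> is only meaningful on families satisfying \<open>istopology\<close>; this
  holds for every ordered structure, see \<open>openin_scott_topology\<close> below. The join in
  \<open>scott_open\<close> is a Hilbert choice; for the locale of open sets it is the union, see
  \<open>sup_open_locale\<close>.\<close>

definition scott_topology :: "('a, 'b) gorder_scheme \<Rightarrow> 'a topology"
  where "scott_topology L = topology (scott_open L)"

definition open_nbhds :: "'a topology \<Rightarrow> 'a \<Rightarrow> 'a set set"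
  where "open_nbhds X x = {V. openin X V \<and> x \<in> V}"

definition phi :: "'a topology \<Rightarrow> 'a set set \<Rightarrow> 'a set"
  where "phi X \<U> = \<Union>{U. openin X U \<and> (\<exists>V\<in>\<U>. U \<inter> V = {})}"

definition f_map :: "'a topology \<Rightarrow> 'a \<Rightarrow> 'a set"
  where "f_map X x = phi X (open_nbhds X x)"

lemma istopology_scott_open: "istopology (scott_open L)"
  unfolding istopology_def
proof (intro conjI allI impI)
  fix S T
  assume S: "scott_open L S" and T: "scott_open L T"
  have "D \<inter> (S \<inter> T) \<noteq> {}" if D: "directed_in L D" and sup: "\<Squnion>\<^bsub>L\<^esub>D \<in> S \<inter> T" for D
  proof -
    obtain a b where ab: "a \<in> D" "a \<in> S" "b \<in> D" "b \<in> T"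
      using S T D sup unfolding scott_open_def by blast
    then obtain c where "c \<in> D" "a \<sqsubseteq>\<^bsub>L\<^esub> c" "b \<sqsubseteq>\<^bsub>L\<^esub> c"
      using D unfolding directed_in_def by blast
    moreover from this have "c \<in> carrier L"
      using D unfolding directed_in_def by blast
    ultimately show ?thesis
      using S T ab unfolding scott_open_def by blast
  qed
  then show "scott_open L (S \<inter> T)"
    using S T unfolding scott_open_def by blast
next
  fix \<K>
  assume K: "\<forall>K\<in>\<K>. scott_open L K"
  show "scott_open L (\<Union>\<K>)"
    unfolding scott_open_def
  proof (intro conjI allI impI ballI)
    show "\<Union>\<K> \<subseteq> carrier L"
      using K unfolding scott_open_def by blast
  next
    fix x y
    assume "x \<in> \<Union>\<K>" "y \<in> carrier L" "x \<sqsubseteq>\<^bsub>L\<^esub> y"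
    then show "y \<in> \<Union>\<K>"
      using K unfolding scott_open_def by blast
  next
    fix D
    assume D: "directed_in L D \<and> \<Squnion>\<^bsub>L\<^esub>D \<in> \<Union>\<K>"
    then obtain S where "S \<in> \<K>" "\<Squnion>\<^bsub>L\<^esub>D \<in> S" by blast
    then have "D \<inter> S \<noteq> {}"
      using K D unfolding scott_open_def by blast
    then show "D \<inter> \<Union>\<K> \<noteq> {}"
      using \<open>S \<in> \<K>\<close> by blast
  qed
qed

lemma openin_scott_topology: "openin (scott_topology L) = scott_open L"
  unfolding scott_topology_def by (rule topology_inverse'[OF istopology_scott_open])

lemma least_Union_open_locale:
  assumes "A \<subseteq> carrier (open_locale X)"
  shows "least (open_locale X) (\<Union>A) (Upper (open_locale X) A)"
  using assms unfolding open_locale_def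
  by (fastforce intro!: least_UpperI openin_Union simp: Upper_def)

lemma complete_lattice_open_locale: "complete_lattice (open_locale X)"
proof (rule partial_order.complete_latticeI)
  show "partial_order (open_locale X)"
    unfolding open_locale_def by standard auto
next
  fix A
  assume "A \<subseteq> carrier (open_locale X)"
  then show "\<exists>s. least (open_locale X) s (Upper (open_locale X) A)"
    using least_Union_open_locale by blast
next
  fix A
  assume A: "A \<subseteq> carrier (open_locale X)"
  have "greatest (open_locale X) (X interior_of (topspace X \<inter> \<Inter>A)) (Lower (open_locale X) A)"
  proof (rule greatest_LowerI)
    fix U
    assume "U \<in> A"
    then show "X interior_of (topspace X \<inter> \<Inter>A) \<sqsubseteq>\<^bsub>open_locale X\<^esub> U"
      using interior_of_subset[of X "topspace X \<inter> \<Inter>A"] by (auto simp: open_locale_def)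
  next
    fix W
    assume W: "W \<in> Lower (open_locale X) A"
    then have "openin X W"
      by (simp add: open_locale_def Lower_def)
    moreover have "W \<subseteq> U" if "U \<in> A" for U
      using W that A by (auto simp: open_locale_def Lower_def)
    ultimately have "W \<subseteq> X interior_of (topspace X \<inter> \<Inter>A)"
      by (intro interior_of_maximal) (auto dest: openin_subset)
    then show "W \<sqsubseteq>\<^bsub>open_locale X\<^esub> X interior_of (topspace X \<inter> \<Inter>A)"
      by (simp add: open_locale_def)
  next
    show "A \<subseteq> carrier (open_locale X)" by (fact A)
    show "X interior_of (topspace X \<inter> \<Inter>A) \<in> carrier (open_locale X)"
      by (simp add: open_locale_def)
  qed
  then show "\<exists>i. greatest (open_locale X) i (Lower (open_locale X) A)" ..
qed

lemma sup_open_locale: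
  assumes "A \<subseteq> carrier (open_locale X)"
  shows "\<Squnion>\<^bsub>open_locale X\<^esub>A = \<Union>A"
proof -
  interpret complete_lattice "open_locale X"
    by (rule complete_lattice_open_locale)
  show ?thesis
    using least_Union_open_locale[OF assms] assms
    unfolding Lattice.sup_def by (metis least_unique someI)
qed

end

(* The point f(x) is the join of the directed family of all open sets that are disjoint from some
   neighborhood of x. If f(x) lies in a Scott open family, a member of this directed family
   already does, which puts x in phi; the converse is upward closure. *)
theory Submission
  imports Defs
begin

text \<open>The whole carrier is Scott open because a directed set is a nonempty subset of it, so it
  always meets it.\<close>

lemma topspace_scott_topology: "topspace (scott_topology L) = carrier L"
proof (rule antisym)
  show "topspace (scott_topology L) \<subseteq> carrier L"
    using openin_topspace[of "scott_topology L"]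
    unfolding openin_scott_topology scott_open_def by blast
  have "scott_open L (carrier L)"
    unfolding scott_open_def directed_in_def by blast
  then show "carrier L \<subseteq> topspace (scott_topology L)"
    by (simp add: openin_subset openin_scott_topology)
qed

lemma openin_phi: "openin X (phi X \<U>)"
  unfolding phi_def by (rule openin_Union) blast

text \<open>The union of two members misses the intersection of their witnessing neighborhoods,
  which is again a neighborhood of \<open>x\<close>.\<close>

lemma directed_disjoint_from_nbhd:
  assumes "x \<in> topspace X"
  shows "directed_in (open_locale X) {U. openin X U \<and> (\<exists>V\<in>open_nbhds X x. U \<inter> V = {})}"
    (is "directed_in _ ?D")
  unfolding directed_in_def
proof (intro conjI ballI)
  show "?D \<subseteq> carrier (open_locale X)"
    by (auto simp: open_locale_def)
  \<comment> \<open>The witness is \<open>topspace X\<close>, a neighborhood of \<open>x\<close> by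
    assumption.\<close>
  have "{} \<in> ?D"
    using assms by (auto simp: open_nbhds_def)
  then show "?D \<noteq> {}" by blast
next
  fix U U'
  assume "U \<in> ?D" "U' \<in> ?D"
  then obtain V V' where V: "openin X U" "openin X V" "x \<in> V" "U \<inter> V = {}"
    and V': "openin X U'" "openin X V'" "x \<in> V'" "U' \<inter> V' = {}"
    by (auto simp: open_nbhds_def)
  have "V \<inter> V' \<in> open_nbhds X x"
    using V V' by (simp add: open_nbhds_def openin_Int)
  moreover have "(U \<union> U') \<inter> (V \<inter> V') = {}"
    using V V' by blast
  ultimately have "U \<union> U' \<in> ?D"
    using V V' by (blast intro: openin_Un)
  then show "\<exists>W\<in>?D. U \<sqsubseteq>\<^bsub>open_locale X\<^esub> W \<and> U' \<sqsubseteq>\<^bsub>open_locale X\<^esub> W"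
    by (rule rev_bexI) (simp add: open_locale_def)
qed

lemma f_map_in_scott_open_iff:
  assumes \<U>: "scott_open (open_locale X) \<U>" and x: "x \<in> topspace X"
  shows "f_map X x \<in> \<U> \<longleftrightarrow> x \<in> phi X \<U>"
proof
  let ?D = "{U. openin X U \<and> (\<exists>V\<in>open_nbhds X x. U \<inter> V = {})}"
  assume f: "f_map X x \<in> \<U>"
  have "?D \<subseteq> carrier (open_locale X)"
    by (auto simp: open_locale_def)
  \<comment> \<open>Scott openness speaks of the abstract join, while \<open>phi\<close> is a union;
    in the locale of open sets the two agree.\<close>
  then have "\<Squnion>\<^bsub>open_locale X\<^esub>?D = f_map X x"
    unfolding f_map_def phi_def by (rule sup_open_locale)
  with f have "\<Squnion>\<^bsub>open_locale X\<^esub>?D \<in> \<U>" by simp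
  moreover have "\<forall>D. directed_in (open_locale X) D \<and> \<Squnion>\<^bsub>open_locale X\<^esub>D \<in> \<U> \<longrightarrow> D \<inter> \<U> \<noteq> {}"
    using \<U> unfolding scott_open_def by (elim conjE)
  ultimately have "?D \<inter> \<U> \<noteq> {}"
    using directed_disjoint_from_nbhd[OF x] by simp
  \<comment> \<open>Roles swap by symmetry of disjointness: \<open>U\<close> is now the member of
    \<open>\<U>\<close>, and the neighborhood \<open>V\<close> of \<open>x\<close> is one of the
    open sets united in \<open>phi X \<U>\<close>.\<close>
  then obtain U V where "U \<in> \<U>" "openin X V" "x \<in> V" "V \<inter> U = {}"
    unfolding open_nbhds_def by blast
  then show "x \<in> phi X \<U>"
    unfolding phi_def by blast
next
  assume "x \<in> phi X \<U>"
  then obtain U V where U: "openin X U" "x \<in> U" and V: "V \<in> \<U>" and disj: "U \<inter> V = {}"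
    unfolding phi_def by blast
  have "openin X V"
    using \<U> V unfolding scott_open_def by (simp add: open_locale_def subset_iff)
  moreover have "U \<in> open_nbhds X x" "V \<inter> U = {}"
    using U disj by (auto simp: open_nbhds_def)
  \<comment> \<open>\<open>V\<close> misses the neighborhood \<open>U\<close> of \<open>x\<close>,
    so it is one of the sets whose union is \<open>f_map X x\<close>.\<close>
  ultimately have "V \<subseteq> f_map X x"
    unfolding f_map_def phi_def by (intro Union_upper) blast
  moreover have "openin X (f_map X x)"
    unfolding f_map_def by (rule openin_phi)
  ultimately show "f_map X x \<in> \<U>"
    using \<U> V unfolding scott_open_def by (simp add: open_locale_def)
qed

theorem lemma3p1:
  fixes X :: "'a topology"
  shows "(\<forall>\<U>. openin (scott_topology (open_locale X)) \<U> \<longrightarrow>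
            {x \<in> topspace X. f_map X x \<in> \<U>} = phi X \<U>)
       \<and> continuous_map X (scott_topology (open_locale X)) (f_map X)"
proof
  show preimage: "\<forall>\<U>. openin (scott_topology (open_locale X)) \<U> \<longrightarrow>
      {x \<in> topspace X. f_map X x \<in> \<U>} = phi X \<U>"
  proof (intro allI impI)
    fix \<U>
    assume "openin (scott_topology (open_locale X)) \<U>"
    then have "scott_open (open_locale X) \<U>"
      by (simp add: openin_scott_topology)
    \<comment> \<open>Being open, \<open>phi X \<U>\<close> contains only points of the space, so
      the pointwise equivalence covers all of it.\<close>
    then show "{x \<in> topspace X. f_map X x \<in> \<U>} = phi X \<U>"
      using f_map_in_scott_open_iff openin_subset[OF openin_phi] by fast
  qed
  have "f_map X x \<in> carrier (open_locale X)" for x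
    by (simp add: f_map_def openin_phi open_locale_def)
  \<comment> \<open>Each preimage of a Scott open family is a \<open>phi X \<U>\<close>, hence
    open.\<close>
  then show "continuous_map X (scott_topology (open_locale X)) (f_map X)"
    using preimage by (simp add: continuous_map topspace_scott_topology openin_phi image_subset_iff)
qed

end
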